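(* Let $K$ be a finite simplicial complex with vertex set $V$, $|V|=n$, and let $f\colon V\to\{1,\dots,n\}$ be an order function (a bijection). Let $x,y\in V$ be order-adjacent vertices with $f(y)=f(x)+1$, and let $f'$ be the order function after their swap: $f'(y)=f(x)$, $f'(x)=f(y)$, and $f'(v)=f(v)$ for $v\notin\{x,y\}$. Let $\sigma\in\overline{\mathrm{St}}(x)\cap\overline{\mathrm{St}}(y)$ and suppose that $\sigma$ is not the tail of any arrow in the colex vector field $F_f$ (equivalently, $c_f(\sigma)\in\sigma$). Then the arrow $\{\sigma\to\{y\}\cup\sigma\}$ appears in $F_{f'}$ if and only if $\sigma\in\mathrm{St}(x)\cap\mathrm{Lk}(y)$ and $\omega(\sigma)=f(x)$.
   Context: Simplices are nonempty finite subsets of $V$; $K$ is closed under taking nonempty subsets. For $v\in V$: $\mathrm{St}(v)=\{\sigma\in K\mid v\in\sigma\}$; $\overline{\mathrm{St}}(v)=\{\sigma\in K\mid\sigma\subseteq\tau\text{ for some }\tau\in\mathrm{St}(v)\}$; $\mathrm{Lk}(v)=\{\sigma\in K\mid v\notin\sigma,\ \{v\}\cup\sigma\in K\}$. The appearance function (of $f$) is $\omega(\sigma)=\min\{f(v)\mid v\in\sigma\}$. For $\sigma\in K$, $V_\sigma=\{v\in V\mid\{v\}\cup\sigma\in K\}$, and for an order function $g$ the candidate vertex is $c_g(\sigma)=\operatorname{argmin}_{v\in V_\sigma}g(v)$. The colex vector field $F_g$ is the collection of pairs (arrows) $\{\alpha\to\beta\}$ of simplices of $K$ of dimensions $p$ and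 $p+1$ (any $p\ge0$) such that $\beta=\{c_g(\alpha)\}\cup\alpha$ and $c_g(\alpha)\notin\alpha$; $\alpha$ is the tail of the arrow. *)

theory Defs
  imports Main
begin

definition simplicial_complex :: "'a set \<Rightarrow> 'a set set \<Rightarrow> bool" where
  "simplicial_complex V K \<longleftrightarrow>
     (\<forall>\<sigma>\<in>K. \<sigma> \<noteq> {} \<and> finite \<sigma> \<and> \<sigma> \<subseteq> V) \<and>
     (\<forall>\<sigma>\<in>K. \<forall>\<tau>. \<tau> \<subseteq> \<sigma> \<longrightarrow> \<tau> \<noteq> {} \<longrightarrow> \<tau> \<in> K)"

text \<open>The truncated subtraction is harmless, since simplices are nonempty.\<close>

definition dimension :: "'a set \<Rightarrow> nat" where
  "dimension \<sigma> = card \<sigma> - 1"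

definition order_function :: "'a set \<Rightarrow> nat \<Rightarrow> ('a \<Rightarrow> nat) \<Rightarrow> bool" where
  "order_function V n g \<longleftrightarrow> bij_betw g V {1..n}"

definition star :: "'a set set \<Rightarrow> 'a \<Rightarrow> 'a set set" where
  "star K v = {\<sigma> \<in> K. v \<in> \<sigma>}"

definition closed_star :: "'a set set \<Rightarrow> 'a \<Rightarrow> 'a set set" where
  "closed_star K v = {\<sigma> \<in> K. \<exists>\<tau>\<in>star K v. \<sigma> \<subseteq> \<tau>}"

definition link :: "'a set set \<Rightarrow> 'a \<Rightarrow> 'a set set" where
  "link K v = {\<sigma> \<in> K. v \<notin> \<sigma> \<and> {v} \<union> \<sigma> \<in> K}"

definition appearance :: "('a \<Rightarrow> nat) \<Rightarrow> 'a set \<Rightarrow> nat" where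
  "appearance g \<sigma> = Min {g v |v. v \<in> \<sigma>}"

text \<open>The set $V_\sigma$; it contains the vertices of $\sigma$ itself.\<close>

definition candidates :: "'a set \<Rightarrow> 'a set set \<Rightarrow> 'a set \<Rightarrow> 'a set" where
  "candidates V K \<sigma> = {v \<in> V. {v} \<union> \<sigma> \<in> K}"

definition candidate_vertex ::
    "'a set \<Rightarrow> 'a set set \<Rightarrow> ('a \<Rightarrow> nat) \<Rightarrow> 'a set \<Rightarrow> 'a" where
  "candidate_vertex V K g \<sigma> = arg_min_on g (candidates V K \<sigma>)"

text \<open>An arrow $\alpha \to \beta$ is the pair \<open>(\<alpha>, \<beta>)\<close>.\<close>

definition colex_field ::
    "'a set \<Rightarrow> 'a set set \<Rightarrow> ('a \<Rightarrow> nat) \<Rightarrow> ('a set \<times> 'a set) set" where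
  "colex_field V K g =
     {(\<alpha>, \<beta>). \<alpha> \<in> K \<and> \<beta> \<in> K \<and> dimension \<beta> = dimension \<alpha> + 1 \<and>
       \<beta> = {candidate_vertex V K g \<alpha>} \<union> \<alpha> \<and> candidate_vertex V K g \<alpha> \<notin> \<alpha>}"

end

theory Submission
  imports Defs
begin

text \<open>All of this is a statement about argmins over the set \<open>V\<^sub>\<sigma>\<close>, which contains \<open>\<sigma>\<close>, \<open>x\<close> and \<open>y\<close>. That
  \<open>\<sigma>\<close> is not a tail means that the argmin \<open>c\<close> of \<open>f\<close> lies in \<open>\<sigma>\<close>, and \<open>f c \<le> f x\<close>. The swap can
  promote \<open>y \<notin> \<sigma>\<close> to argmin only by displacing \<open>x\<close>, that is, if \<open>c = x\<close>.\<close>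

text \<open>Injectivity makes the minimiser unique, so the choice hidden in
  \<open>arg_min_on\<close> is determined by minimality alone.\<close>

lemma candidate_vertex_eq_iff:
  assumes "finite (candidates V K \<sigma>)" and "candidates V K \<sigma> \<noteq> {}"
    and "inj_on g (candidates V K \<sigma>)"
  shows "candidate_vertex V K g \<sigma> = v \<longleftrightarrow>
    v \<in> candidates V K \<sigma> \<and> (\<forall>w \<in> candidates V K \<sigma>. g v \<le> g w)"
proof -
  let ?C = "candidates V K \<sigma>" and ?c = "candidate_vertex V K g \<sigma>"
  have c: "?c \<in> ?C" "\<forall>w \<in> ?C. g ?c \<le> g w"
    using arg_min_if_finite(1)[OF assms(1,2), of g] arg_min_least[OF assms(1,2), of _ g]
    by (auto simp: candidate_vertex_def)
  show ?thesis
  proof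
    show "v \<in> ?C \<and> (\<forall>w \<in> ?C. g v \<le> g w)" if "?c = v"
      using c that by blast
    show "?c = v" if "v \<in> ?C \<and> (\<forall>w \<in> ?C. g v \<le> g w)"
      using c that assms(3) by (meson inj_onD order_antisym)
  qed
qed

text \<open>Membership in \<open>candidates\<close> puts the head of the arrow in \<open>K\<close>.
  A vertex outside \<sigma> raises the cardinality by one, and since
  \<open>card \<sigma> > 0\<close> the truncated subtraction in \<open>dimension\<close> raises by
  one as well.\<close>

lemma colex_field_iff:
  assumes "simplicial_complex V K" and "\<sigma> \<in> K"
    and "candidate_vertex V K g \<sigma> \<in> candidates V K \<sigma>"
  shows "(\<sigma>, \<beta>) \<in> colex_field V K g \<longleftrightarrow>
    candidate_vertex V K g \<sigma> \<notin> \<sigma> \<and> \<beta> = {candidate_vertex V K g \<sigma>} \<union> \<sigma>"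
proof -
  have "finite \<sigma>" "card \<sigma> > 0"
    using assms(1,2) by (auto simp: simplicial_complex_def card_gt_0_iff)
  then show ?thesis
    using assms(2,3) by (auto simp: colex_field_def candidates_def dimension_def)
qed

text \<open>A simplex of the star that has \<sigma> as a face also contains \<open>v\<close>, so
  \<open>{v} \<union> \<sigma>\<close> is one of its nonempty faces.\<close>

lemma closed_star_imp_candidate:
  assumes "simplicial_complex V K" and "\<sigma> \<in> closed_star K v"
  shows "v \<in> candidates V K \<sigma>"
proof -
  obtain \<tau> where \<tau>: "\<tau> \<in> K" "v \<in> \<tau>" "\<sigma> \<subseteq> \<tau>"
    using assms(2) unfolding closed_star_def star_def by blast
  then have "\<tau> \<subseteq> V"
    using assms(1) by (simp add: simplicial_complex_def)
  moreover have "{v} \<union> \<sigma> \<in> K"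
    using assms(1) \<tau> unfolding simplicial_complex_def
    by (metis Un_least empty_subsetI insert_subset insert_not_empty insert_is_Un)
  ultimately show ?thesis
    using \<tau>(2) by (auto simp: candidates_def)
qed

lemma simplex_subset_candidates:
  assumes "simplicial_complex V K" and "\<sigma> \<in> K"
  shows "\<sigma> \<subseteq> candidates V K \<sigma>"
  using assms by (auto simp: simplicial_complex_def candidates_def insert_absorb)

lemma appearance_eq_iff:
  assumes "finite \<sigma>" and "v \<in> \<sigma>"
  shows "appearance g \<sigma> = g v \<longleftrightarrow> (\<forall>w \<in> \<sigma>. g v \<le> g w)"
proof -
  have "{g w |w. w \<in> \<sigma>} = g ` \<sigma>" by auto
  then show ?thesis
    using assms Min_eq_iff[of "g ` \<sigma>" "g v"] by (auto simp: appearance_def)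
qed

theorem lemma4p5:
  fixes V :: "'a set" and K :: "'a set set" and n :: nat
    and f f' :: "'a \<Rightarrow> nat" and x y :: 'a and \<sigma> :: "'a set"
  assumes "finite V" and "card V = n"
    and "simplicial_complex V K"
    and "order_function V n f"
    and "x \<in> V" and "y \<in> V" and "f y = f x + 1"
    and "f' y = f x" and "f' x = f y" and "\<And>v. v \<in> V - {x, y} \<Longrightarrow> f' v = f v"
    and "\<sigma> \<in> closed_star K x \<inter> closed_star K y"
    and "\<not> (\<exists>\<beta>. (\<sigma>, \<beta>) \<in> colex_field V K f)"
  shows "(\<sigma>, {y} \<union> \<sigma>) \<in> colex_field V K f' \<longleftrightarrow>
           \<sigma> \<in> star K x \<inter> link K y \<and> appearance f \<sigma> = f x"
proof -
  let ?C = "candidates V K \<sigma>"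
  let ?c = "candidate_vertex V K f \<sigma>" and ?c' = "candidate_vertex V K f' \<sigma>"
  have \<sigma>K: "\<sigma> \<in> K"
    using assms(11) by (auto simp: closed_star_def)
  then have fin: "finite \<sigma>"
    using assms(3) by (auto simp: simplicial_complex_def)
  have xC: "x \<in> ?C" and yC: "y \<in> ?C"
    using closed_star_imp_candidate[OF assms(3)] assms(11) by auto
  have sub: "\<sigma> \<subseteq> ?C" "?C \<subseteq> V"
    using simplex_subset_candidates[OF assms(3) \<sigma>K] by (auto simp: candidates_def)
  have C: "finite ?C" "?C \<noteq> {}"
    using xC sub(2) assms(1) finite_subset by auto
  have inj: "inj_on f V"
    using assms(4) by (simp add: order_function_def bij_betw_def)
  have f'_eq: "f' v = (if v = x then f y else if v = y then f x else f v)" if "v \<in> V" for v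
    using assms(8-10) that by auto
  \<comment> \<open>The swap only exchanges the values at \<open>x\<close> and \<open>y\<close>, so
    a collision under \<open>f'\<close> yields one under \<open>f\<close>; the cases compare
    \<open>u\<close> and \<open>v\<close> with each other and with \<open>x\<close> and
    \<open>y\<close>.\<close>
  have "inj_on f' V"
  proof (rule inj_onI)
    fix u v assume "u \<in> V" "v \<in> V" "f' u = f' v"
    then show "u = v"
      using f'_eq[of u] f'_eq[of v] inj_onD[OF inj, of u v] inj_onD[OF inj, of u x]
        inj_onD[OF inj, of u y] inj_onD[OF inj, of v x] inj_onD[OF inj, of v y] assms(5,6) by (auto split: if_splits)
  qed
  note c_iff = candidate_vertex_eq_iff[OF C inj_on_subset[OF inj sub(2)]]
    and c'_iff = candidate_vertex_eq_iff[OF C inj_on_subset[OF \<open>inj_on f' V\<close> sub(2)]]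
  have cC: "?c \<in> ?C" and c_le: "\<And>w. w \<in> ?C \<Longrightarrow> f ?c \<le> f w"
    using c_iff[of ?c] by auto
  have c'C: "?c' \<in> ?C"
    using c'_iff[of ?c'] by auto
  have c_in: "?c \<in> \<sigma>"
    using assms(12) colex_field_iff[OF assms(3) \<sigma>K cC] by blast
  \<comment> \<open>Since \<open>x\<close> is a candidate, \<open>f ?c \<le> f x\<close> always
    holds; below it thus suffices to show \<open>f x \<le> f ?c\<close> to conclude
    \<open>?c = x\<close>.\<close>
  have c_x: "?c = x" if "f ?c = f x"
    using inj_onD[OF inj that] cC sub(2) assms(5) by blast
  \<comment> \<open>If \<open>?c'\<close> lies outside \<sigma>, then
    \<open>{?c'} \<union> \<sigma> = {y} \<union> \<sigma>\<close> forces
    \<open>?c' = y\<close>.\<close>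
  have "(\<sigma>, {y} \<union> \<sigma>) \<in> colex_field V K f' \<longleftrightarrow> ?c' = y \<and> y \<notin> \<sigma>"
    unfolding colex_field_iff[OF assms(3) \<sigma>K c'C] by (metis UnCI UnE insertCI singletonD)
  also have "\<dots> \<longleftrightarrow> ?c = x \<and> y \<notin> \<sigma>"
  proof -
    have "?c = x" if "?c' = y" "y \<notin> \<sigma>"
    proof (rule ccontr)
      assume "?c \<noteq> x"
      \<comment> \<open>As \<open>?c\<close> lies in \<sigma> and \<open>y\<close> does not, the old
        argmin is a vertex that the swap leaves fixed.\<close>
      moreover have "?c \<noteq> y" "?c \<in> V"
        using c_in that(2) cC sub(2) by auto
      ultimately have "f' ?c = f ?c"
        using f'_eq by simp
      moreover have "f' y \<le> f' ?c"
        using c'_iff that(1) cC by blast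
      ultimately have "f x \<le> f ?c"
        using assms(8) by simp
      then show False
        using c_x[OF order_antisym[OF c_le[OF xC]]] \<open>?c \<noteq> x\<close> by blast
    qed
    moreover have "?c' = y" if "?c = x"
    proof -
      \<comment> \<open>Here \<open>f' y = f x\<close> is the minimum of \<open>f\<close> on
        \<open>?C\<close>. At \<open>w = x\<close> the new value is \<open>f y = f x + 1\<close>,
        and vertices other than \<open>x\<close> and \<open>y\<close> keep their values.\<close>
      have "f' y \<le> f' w" if "w \<in> ?C" for w
        using c_le[OF that] \<open>?c = x\<close> that sub(2) f'_eq[of w] assms(7,8)
        by (auto split: if_splits)
      then show ?thesis
        using c'_iff yC by blast
    qed
    ultimately show ?thesis by blast
  qed
  also have "\<dots> \<longleftrightarrow> \<sigma> \<in> star K x \<inter> link K y \<and> appearance f \<sigma> = f x"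
  proof -
    have "?c = x \<longleftrightarrow> x \<in> \<sigma> \<and> (\<forall>w \<in> \<sigma>. f x \<le> f w)"
    proof
      show "x \<in> \<sigma> \<and> (\<forall>w \<in> \<sigma>. f x \<le> f w)" if "?c = x"
        using that c_in c_le sub(1) by blast
      \<comment> \<open>The minimum over \<sigma> is already the minimum over \<open>?C\<close>,
        because \<open>?c\<close> lies in \<sigma>.\<close>
      show "?c = x" if "x \<in> \<sigma> \<and> (\<forall>w \<in> \<sigma>. f x \<le> f w)"
        using c_x[OF order_antisym[OF c_le[OF xC]]] that c_in by blast
    qed
    \<comment> \<open>With this, \<open>\<sigma> \<in> link K y\<close> reduces to
      \<open>y \<notin> \<sigma>\<close>.\<close>
    moreover have "{y} \<union> \<sigma> \<in> K"
      using yC by (simp add: candidates_def)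
    ultimately show ?thesis
      using \<sigma>K appearance_eq_iff[OF fin, of x f] by (simp add: star_def link_def) blast
  qed
  finally show ?thesis .
qed

end
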